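(* Let $k\ge 2$ be an integer. Every properly edge-colored $n$-vertex graph $G$ with at least $10^5 k^3 n^{1+1/k}$ edges contains a rainbow cycle of length $2k$.
   Context: A proper edge-coloring assigns colors to edges so that any two edges sharing a vertex receive different colors. A subgraph is rainbow if all of its edges receive distinct colors. *)

theory Defs
  imports Complex_Main "HOL-Library.Ramsey"
begin

text \<open>
  Graphs are finite and simple: an edge is a two-element set of vertices. Colours may come
  from an arbitrary type; only the values of a colouring on the edge set matter.
\<close>

definition simple_graph :: "'a set \<Rightarrow> 'a set set \<Rightarrow> bool" where
  "simple_graph V E \<longleftrightarrow> finite V \<and> E \<subseteq> nsets V 2"

definition proper_edge_coloring :: "'a set set \<Rightarrow> ('a set \<Rightarrow> 'c) \<Rightarrow> bool" where
  "proper_edge_coloring E c \<longleftrightarrow>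
     (\<forall>e\<in>E. \<forall>f\<in>E. e \<noteq> f \<and> e \<inter> f \<noteq> {} \<longrightarrow> c e \<noteq> c f)"

definition rainbow :: "('a set \<Rightarrow> 'c) \<Rightarrow> 'a set set \<Rightarrow> bool" where
  "rainbow c F \<longleftrightarrow> inj_on c F"

definition cycle_edges :: "'a list \<Rightarrow> 'a set set" where
  "cycle_edges vs = {{vs ! i, vs ! (Suc i mod length vs)} | i. i < length vs}"

text \<open>
  A cycle has no isolated vertices, so it is represented by its edge set. The bound on the
  length excludes a single edge traversed back and forth.
\<close>

definition is_cycle :: "nat \<Rightarrow> 'a set set \<Rightarrow> bool" where
  "is_cycle m C \<longleftrightarrow>
     m \<ge> 3 \<and> (\<exists>vs. length vs = m \<and> distinct vs \<and> C = cycle_edges vs)"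

end

theory Submission
  imports Defs "HOL-Analysis.Convex"
begin

text \<open>
  Closed walks of length \<open>2k\<close> are counted by the trace of the \<open>2k\<close>-th power of the adjacency matrix.
  A closed walk that is not a rainbow cycle repeats a vertex or a colour at two positions. By a
  log-convexity argument the number of such walks is largest when the two positions are as close as
  possible, and then it is at most the maximum degree \<open>D\<close> times the trace of the \<open>(2k-2)\<close>-th power.
  So without a rainbow \<open>2k\<close>-cycle the trace of the \<open>2k\<close>-th power is at most \<open>8k\<^sup>2D\<close> times that of the
  \<open>(2k-2)\<close>-th power. If all edges meet a vertex set \<open>B\<close>, the adjacency matrix has rank at most
  \<open>2|B|\<close>, and comparing traces bounds the number \<open>e\<close> of edges by
  \<open>e\<^sup>2 \<le> 16 k\<^sup>2 D n |B| |B|\<^bsup>1/k\<^esup>\<close>. The edges of the graph are now split dyadically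
  by the larger degree of their endpoints, where \<open>D\<close> and \<open>B\<close> balance out, and the bounds are summed
  by Cauchy-Schwarz; the sum of the powers of \<open>2\<^bsup>-1/k\<^esup>\<close> costs the third factor \<open>k\<close>.
\<close>

section \<open>Log-convex sequences\<close>

text \<open>The ratios \<open>a (Suc j) / a j\<close> do not decrease, so each is at least
  \<open>a 1 / a 0\<close>; the product form also covers vanishing terms.\<close>

lemma log_convex_first_le:
  fixes a :: "nat \<Rightarrow> real"
  assumes nn: "\<And>j. 0 \<le> a j" and lc: "\<And>j. (a (Suc j))\<^sup>2 \<le> a j * a (Suc (Suc j))"
  shows "a 1 * a j \<le> a 0 * a (Suc j)"
proof (induction j)
  case 0
  then show ?case by (simp add: mult.commute)
next
  case (Suc j)
  show ?case
  proof (cases "a (Suc j) = 0")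
    case True
    then show ?thesis using nn by simp
  next
    case False
    then have pos: "a (Suc j) > 0" using nn[of "Suc j"] by simp
    have "a (Suc j) * (a 1 * a (Suc j)) = a 1 * (a (Suc j))\<^sup>2"
      by (simp add: power2_eq_square)
    also have "\<dots> \<le> a 1 * (a j * a (Suc (Suc j)))"
      using lc nn by (intro mult_left_mono) auto
    also have "\<dots> = (a 1 * a j) * a (Suc (Suc j))" by simp
    also have "\<dots> \<le> (a 0 * a (Suc j)) * a (Suc (Suc j))"
      using Suc nn by (intro mult_right_mono) auto
    also have "\<dots> = a (Suc j) * (a 0 * a (Suc (Suc j)))" by simp
    finally show ?thesis using pos by simp
  qed
qed

text \<open>\<open>a (Suc k) / a 0\<close> is a product of \<open>Suc k\<close> ratios, each at
  least \<open>a 1 / a 0\<close>. This will compare walks of length 2 with walks of length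
  \<open>2 * k\<close>.\<close>

lemma log_convex_power_le:
  fixes a :: "nat \<Rightarrow> real"
  assumes nn: "\<And>j. 0 \<le> a j" and lc: "\<And>j. (a (Suc j))\<^sup>2 \<le> a j * a (Suc (Suc j))"
  shows "a 1 ^ Suc k \<le> a 0 ^ k * a (Suc k)"
proof (induction k)
  case 0
  then show ?case by simp
next
  case (Suc k)
  have "a 1 ^ Suc (Suc k) \<le> a 1 * (a 0 ^ k * a (Suc k))"
    using Suc nn by (simp add: mult_left_mono)
  also have "\<dots> = a 0 ^ k * (a 1 * a (Suc k))" by simp
  also have "\<dots> \<le> a 0 ^ k * (a 0 * a (Suc (Suc k)))"
    using log_convex_first_le[of a, OF nn lc] nn by (intro mult_left_mono) auto
  finally show ?case by (simp add: mult_ac)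
qed

text \<open>In logarithms, \<open>k\<close> is the convex combination of \<open>0\<close> and
  \<open>Suc k\<close> with weights \<open>1 / Suc k\<close> and \<open>k / Suc k\<close>. This will
  bound a trace by the one that is two steps longer.\<close>

lemma log_convex_power_le':
  fixes a :: "nat \<Rightarrow> real"
  assumes nn: "\<And>j. 0 \<le> a j" and lc: "\<And>j. (a (Suc j))\<^sup>2 \<le> a j * a (Suc (Suc j))"
  shows "a k ^ Suc k \<le> a 0 * a (Suc k) ^ k"
proof (induction k)
  case 0
  then show ?case by simp
next
  case (Suc k)
  show ?case
  proof (cases "a (Suc k) = 0")
    case True
    then show ?thesis using nn by simp
  next
    case False
    then have pos: "a (Suc k) > 0" using nn[of "Suc k"] by simp
    \<comment> \<open>The extra factor raises the exponent to \<open>2 * Suc k\<close>, so that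
      log-convexity applies to the square; it cancels at the end.\<close>
    have "a (Suc k) ^ k * a (Suc k) ^ Suc (Suc k) = ((a (Suc k))\<^sup>2) ^ Suc k"
      by (simp add: power_mult_distrib power2_eq_square algebra_simps)
    also have "\<dots> \<le> (a k * a (Suc (Suc k))) ^ Suc k"
      using lc by (intro power_mono) auto
    also have "\<dots> = a k ^ Suc k * a (Suc (Suc k)) ^ Suc k" by (simp only: power_mult_distrib)
    also have "\<dots> \<le> (a 0 * a (Suc k) ^ k) * a (Suc (Suc k)) ^ Suc k"
      using Suc nn by (intro mult_right_mono) auto
    also have "\<dots> = a (Suc k) ^ k * (a 0 * a (Suc (Suc k)) ^ Suc k)" by simp
    finally show ?thesis using pos by (simp del: power_Suc)
  qed
qed

text \<open>Nonnegativity is given at even points only, so the maximum \<open>m\<close> is taken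
  over these. Reflection puts a maximal point \<open>2 * p\<close> into the first half, where
  \<open>lc\<close> may be used with \<open>q = 2 * p\<close>: then \<open>m * m\<close> is at most
  \<open>F 0 * F (4 * p)\<close>, hence at most \<open>F 0 * m\<close>. All other points follow from
  \<open>lc\<close> against \<open>F 0\<close> and symmetry.\<close>

lemma symmetric_log_convex_le:
  fixes F :: "nat \<Rightarrow> real"
  assumes sym: "\<And>a. a \<le> 2 * s \<Longrightarrow> F (2 * s - a) = F a"
    and lc: "\<And>p q. p \<le> s \<Longrightarrow> q \<le> s \<Longrightarrow> (F (p + q))\<^sup>2 \<le> F (2 * p) * F (2 * q)"
    and nn: "\<And>p. p \<le> s \<Longrightarrow> 0 \<le> F (2 * p)"
    and a: "a \<le> 2 * s"
  shows "F a \<le> F 0"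
proof -
  have F0: "0 \<le> F 0" using nn[of 0] by simp
  define m where "m = Max ((\<lambda>p. F (2 * p)) ` {..s})"
  have mge: "F (2 * p) \<le> m" if "p \<le> s" for p
    unfolding m_def using that by (intro Max_ge) auto
  have "m \<in> (\<lambda>p. F (2 * p)) ` {..s}"
    unfolding m_def by (intro Max_in) auto
  then obtain p0 where p0: "p0 \<le> s" "m = F (2 * p0)" by auto
  obtain p where p: "2 * p \<le> s" "m = F (2 * p)"
  proof (cases "2 * p0 \<le> s")
    case True
    then show ?thesis using p0 that by blast
  next
    case False
    have "F (2 * (s - p0)) = m" using sym[of "2 * p0"] p0 by (simp add: diff_mult_distrib2)
    then show ?thesis using that[of "s - p0"] False by simp
  qed
  have "m * m \<le> F 0 * F (2 * (2 * p))"
    using lc[of 0 "2 * p"] p by (simp add: power2_eq_square)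
  also have "\<dots> \<le> F 0 * m" using mge[of "2 * p"] p F0 by (intro mult_left_mono) auto
  finally have m: "m \<le> F 0"
    using F0 by (cases "m > 0") auto
  have *: "F a \<le> F 0" if "a \<le> s" for a
  proof -
    have "(F a)\<^sup>2 \<le> F 0 * F (2 * a)" using lc[of 0 a] that by simp
    also have "\<dots> \<le> F 0 * F 0" using mge[OF that] m F0 by (intro mult_left_mono) auto
    finally show ?thesis using F0 by (metis power2_eq_square power2_le_imp_le)
  qed
  show ?thesis
  proof (cases "a \<le> s")
    case False
    then show ?thesis using *[of "2 * s - a"] sym[OF a] by simp
  qed (rule *)
qed

text \<open>By Bernoulli's inequality \<open>(1 - 1 / (2 * k)) ^ k\<close> is at least 1/2, so the
  root \<open>r\<close> of 1/2 is at most \<open>1 - 1 / (2 * k)\<close>, and the whole geometric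
  series is at most \<open>2 * k\<close>.\<close>

lemma sum_geometric_root_le:
  assumes k: "1 \<le> k" and r0: "0 \<le> r" and r: "r ^ k = 1 / (2::real)" and I: "finite I"
  shows "(\<Sum>i\<in>I. r ^ i) \<le> 2 * real k"
proof -
  obtain l where l: "k = Suc l" using k by (cases k) auto
  let ?x = "1 / (2 * real k)"
  have x: "0 < ?x" "?x \<le> 1 / 2" using k by (simp_all add: divide_simps)
  have "1 + real k * (- ?x) \<le> (1 + (- ?x)) ^ k"
    using x by (intro Bernoulli_inequality) simp
  moreover have "1 + real k * (- ?x) = 1 / 2" using k by (simp add: field_simps)
  ultimately have "r ^ Suc l \<le> (1 + (- ?x)) ^ Suc l" unfolding l[symmetric] r by (simp only:)
  then have "r \<le> 1 + (- ?x)" by (rule power_le_imp_le_base) (use x in linarith)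
  then have r1: "r \<le> 1 - ?x" by simp
  then have r2: "norm r < 1" using r0 x(1) unfolding real_norm_def by linarith
  have "(\<Sum>i\<in>I. r ^ i) \<le> (\<Sum>i. r ^ i)"
    using r0 by (intro sum_le_suminf summable_geometric r2 I) auto
  also have "\<dots> = 1 / (1 - r)" by (intro suminf_geometric r2)
  also have "\<dots> \<le> 1 / ?x" by (rule frac_le) (use x r1 in linarith)+
  finally show ?thesis by simp
qed

text \<open>Cauchy-Schwarz with the factors \<open>sqrt (Q * y i)\<close> and
  \<open>sqrt (r ^ i)\<close>; thanks to the decay in \<open>i\<close> the loss is
  \<open>2 * k\<close> instead of the number of summands.\<close>

lemma sum_sq_le_geometric:
  fixes x y :: "nat \<Rightarrow> real"
  assumes k: "1 \<le> k" and r0: "0 \<le> r" and r: "r ^ k = 1 / (2::real)" and I: "finite I"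
    and Q: "0 \<le> Q" and y: "\<And>i. i \<in> I \<Longrightarrow> 0 \<le> y i"
    and x: "\<And>i. i \<in> I \<Longrightarrow> 0 \<le> x i \<and> (x i)\<^sup>2 \<le> Q * y i * r ^ i"
  shows "(\<Sum>i\<in>I. x i)\<^sup>2 \<le> Q * (\<Sum>i\<in>I. y i) * (2 * real k)"
proof -
  have "x i \<le> sqrt (Q * y i) * sqrt (r ^ i)" if "i \<in> I" for i
    using x[OF that] by (metis real_le_rsqrt real_sqrt_mult)
  then have "(\<Sum>i\<in>I. x i)\<^sup>2 \<le> (\<Sum>i\<in>I. sqrt (Q * y i) * sqrt (r ^ i))\<^sup>2"
    using x by (intro power_mono sum_mono sum_nonneg) auto
  also have "\<dots> \<le> (\<Sum>i\<in>I. (sqrt (Q * y i))\<^sup>2) * (\<Sum>i\<in>I. (sqrt (r ^ i))\<^sup>2)"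
    by (rule Cauchy_Schwarz_ineq_sum)
  also have "\<dots> = (Q * (\<Sum>i\<in>I. y i)) * (\<Sum>i\<in>I. r ^ i)"
    using Q y r0 by (simp add: sum_distrib_left)
  also have "\<dots> \<le> (Q * (\<Sum>i\<in>I. y i)) * (2 * real k)"
    using sum_geometric_root_le[OF k r0 r I] Q y by (intro mult_left_mono mult_nonneg_nonneg sum_nonneg)
  finally show ?thesis .
qed

section \<open>Real matrices indexed by a finite set\<close>

definition mmul :: "'a set \<Rightarrow> ('a \<Rightarrow> 'a \<Rightarrow> real) \<Rightarrow> ('a \<Rightarrow> 'a \<Rightarrow> real) \<Rightarrow> 'a \<Rightarrow> 'a \<Rightarrow> real" where
  "mmul V A B = (\<lambda>u v. \<Sum>w\<in>V. A u w * B w v)"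

definition mid :: "'a set \<Rightarrow> 'a \<Rightarrow> 'a \<Rightarrow> real" where
  "mid V = (\<lambda>u v. of_bool (u = v \<and> u \<in> V))"

definition mtr :: "'a set \<Rightarrow> ('a \<Rightarrow> 'a \<Rightarrow> real) \<Rightarrow> real" where
  "mtr V A = (\<Sum>v\<in>V. A v v)"

text \<open>Matrices are total functions, so entries outside \<open>V\<close> have to vanish for
  \<open>mid V\<close> to be neutral up to equality of functions.\<close>

definition supported :: "'a set \<Rightarrow> ('a \<Rightarrow> 'a \<Rightarrow> real) \<Rightarrow> bool" where
  "supported V A \<longleftrightarrow> (\<forall>u v. A u v \<noteq> 0 \<longrightarrow> u \<in> V \<and> v \<in> V)"

fun mprod :: "'a set \<Rightarrow> ('a \<Rightarrow> 'a \<Rightarrow> real) list \<Rightarrow> 'a \<Rightarrow> 'a \<Rightarrow> real" where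
  "mprod V [] = mid V"
| "mprod V (A # As) = mmul V A (mprod V As)"

abbreviation mpow :: "'a set \<Rightarrow> ('a \<Rightarrow> 'a \<Rightarrow> real) \<Rightarrow> nat \<Rightarrow> 'a \<Rightarrow> 'a \<Rightarrow> real" where
  "mpow V A l \<equiv> mprod V (replicate l A)"

lemma mmul_assoc: "mmul V (mmul V A B) C = mmul V A (mmul V B C)"
proof (intro ext)
  fix u v
  have "mmul V (mmul V A B) C u v = (\<Sum>w\<in>V. \<Sum>x\<in>V. A u x * B x w * C w v)"
    by (simp add: mmul_def sum_distrib_right)
  also have "\<dots> = (\<Sum>x\<in>V. \<Sum>w\<in>V. A u x * B x w * C w v)"
    by (rule sum.swap)
  also have "\<dots> = mmul V A (mmul V B C) u v"
    by (simp add: mmul_def sum_distrib_left mult.assoc)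
  finally show "mmul V (mmul V A B) C u v = mmul V A (mmul V B C) u v" .
qed

lemma supported_mid: "supported V (mid V)"
  by (simp add: supported_def mid_def)

lemma supported_mmul: "supported V A \<Longrightarrow> supported V B \<Longrightarrow> supported V (mmul V A B)"
  unfolding supported_def mmul_def
  by (fastforce elim: sum.not_neutral_contains_not_neutral)

lemma mmul_mid_left:
  assumes "finite V" "supported V A" shows "mmul V (mid V) A = A"
proof (intro ext)
  fix u v
  show "mmul V (mid V) A u v = A u v"
  proof (cases "u \<in> V")
    case True
    then have "mmul V (mid V) A u v = (\<Sum>w\<in>V. if u = w then A w v else 0)"
      unfolding mmul_def mid_def by (intro sum.cong) auto
    then show ?thesis using True assms by simp
  next
    case False
    then show ?thesis using assms unfolding mmul_def mid_def supported_def by auto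
  qed
qed

lemma mmul_mid_right:
  assumes "finite V" "supported V A" shows "mmul V A (mid V) = A"
proof (intro ext)
  fix u v
  show "mmul V A (mid V) u v = A u v"
  proof (cases "v \<in> V")
    case True
    then have "mmul V A (mid V) u v = (\<Sum>w\<in>V. if w = v then A u w else 0)"
      unfolding mmul_def mid_def by (intro sum.cong) auto
    then show ?thesis using True assms by simp
  next
    case False
    then show ?thesis using assms unfolding mmul_def mid_def supported_def
      by (auto intro!: sum.neutral)
  qed
qed

lemma supported_mprod: "(\<And>A. A \<in> set As \<Longrightarrow> supported V A) \<Longrightarrow> supported V (mprod V As)"
  by (induction As) (auto intro: supported_mid supported_mmul)

lemma mprod_append:
  assumes "finite V" "\<And>A. A \<in> set Bs \<Longrightarrow> supported V A"
  shows "mprod V (As @ Bs) = mmul V (mprod V As) (mprod V Bs)"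
  by (induction As) (auto simp: mmul_assoc mmul_mid_left assms supported_mprod)

lemma mtr_mmul_commute: "mtr V (mmul V A B) = mtr V (mmul V B A)"
  unfolding mtr_def mmul_def by (subst sum.swap) (simp add: mult.commute)

text \<open>The trace of a product is the Frobenius inner product of \<open>A\<close> with the
  transpose of \<open>B\<close>.\<close>

lemma mtr_Cauchy_Schwarz:
  assumes "finite V"
  shows "(mtr V (mmul V A B))\<^sup>2 \<le> mtr V (mmul V A (\<lambda>u v. A v u)) * mtr V (mmul V (\<lambda>u v. B v u) B)"
proof -
  have "(mtr V (mmul V A B))\<^sup>2 = (\<Sum>(u, w)\<in>V \<times> V. A u w * B w u)\<^sup>2"
    unfolding mtr_def mmul_def by (simp add: sum.cartesian_product)
  also have "\<dots> \<le> (\<Sum>(u, w)\<in>V \<times> V. (A u w)\<^sup>2) * (\<Sum>(u, w)\<in>V \<times> V. (B w u)\<^sup>2)"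
    using Cauchy_Schwarz_ineq_sum[of "\<lambda>(u, w). A u w" "\<lambda>(u, w). B w u" "V \<times> V"]
    by (simp add: case_prod_beta)
  finally show ?thesis
    unfolding mtr_def mmul_def by (simp add: sum.cartesian_product power2_eq_square)
qed

lemma mmul_transpose: "(\<lambda>u v. mmul V A B v u) = mmul V (\<lambda>u v. B v u) (\<lambda>u v. A v u)"
  by (simp add: mmul_def mult.commute)

section \<open>Walks following prescribed relations\<close>

definition bmat :: "('a \<Rightarrow> 'a \<Rightarrow> bool) \<Rightarrow> 'a \<Rightarrow> 'a \<Rightarrow> real" where
  "bmat R = (\<lambda>u v. of_bool (R u v))"

text \<open>Each step has its own relation, so that walks with extra conditions at chosen steps are
  counted by a product of different 0/1 matrices. A closed walk lists its base point at both
  ends.\<close>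

definition walks :: "('a \<Rightarrow> 'a \<Rightarrow> bool) list \<Rightarrow> 'a \<Rightarrow> 'a \<Rightarrow> 'a list set" where
  "walks Rs u v = {xs. length xs = Suc (length Rs) \<and> xs ! 0 = u \<and> xs ! length Rs = v \<and>
     (\<forall>i<length Rs. (Rs ! i) (xs ! i) (xs ! Suc i))}"

lemma walks_Nil: "walks [] u v = (if u = v then {[u]} else {})"
  unfolding walks_def by (auto simp: length_Suc_conv)

lemma walks_Cons: "walks (R # Rs) u v = (\<Union>w\<in>{w. R u w}. (#) u ` walks Rs w v)"
proof (intro set_eqI iffI)
  fix xs assume xs: "xs \<in> walks (R # Rs) u v"
  then obtain ys where ys: "xs = u # ys" "length ys = Suc (length Rs)"
    unfolding walks_def by (auto simp: length_Suc_conv)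
  have "R u (ys ! 0)" "ys \<in> walks Rs (ys ! 0) v"
    using xs ys unfolding walks_def by (auto simp: All_less_Suc2)
  then show "xs \<in> (\<Union>w\<in>{w. R u w}. (#) u ` walks Rs w v)" using ys by auto
next
  fix xs assume "xs \<in> (\<Union>w\<in>{w. R u w}. (#) u ` walks Rs w v)"
  then show "xs \<in> walks (R # Rs) u v"
    unfolding walks_def by (auto simp: All_less_Suc2)
qed

text \<open>Sorting the walks by their second vertex gives the recursion of matrix
  multiplication.\<close>

lemma card_walks:
  assumes "finite V" and "\<And>R x y. R \<in> set Rs \<Longrightarrow> R x y \<Longrightarrow> x \<in> V \<and> y \<in> V" and "u \<in> V"
  shows "finite (walks Rs u v) \<and> real (card (walks Rs u v)) = mprod V (map bmat Rs) u v"
  using assms(2,3)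
proof (induction Rs arbitrary: u)
  case Nil
  then show ?case by (simp add: walks_Nil mid_def)
next
  case (Cons R Rs)
  have sub: "{w. R u w} \<subseteq> V" using Cons.prems by force
  then have fin: "finite {w. R u w}" using assms(1) finite_subset by blast
  have IH: "finite (walks Rs w v)" "real (card (walks Rs w v)) = mprod V (map bmat Rs) w v"
    if "R u w" for w
    using Cons.IH[of w] Cons.prems that sub by auto
  have disj: "(#) u ` walks Rs w v \<inter> (#) u ` walks Rs w' v = {}" if "w \<noteq> w'" for w w'
    using that unfolding walks_def by auto
  have "real (card (walks (R # Rs) u v)) = (\<Sum>w | R u w. real (card ((#) u ` walks Rs w v)))"
    unfolding walks_Cons using fin IH disj by (subst card_UN_disjoint) auto
  also have "\<dots> = (\<Sum>w | R u w. mprod V (map bmat Rs) w v)"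
    using IH by (intro sum.cong) (auto simp: card_image)
  also have "\<dots> = (\<Sum>w\<in>V. bmat R u w * mprod V (map bmat Rs) w v)"
    unfolding bmat_def using sub assms(1) by (intro sum.mono_neutral_cong_left) auto
  finally show ?case
    using fin IH by (simp add: walks_Cons mmul_def)
qed

definition closed_walks :: "'a set \<Rightarrow> ('a \<Rightarrow> 'a \<Rightarrow> bool) list \<Rightarrow> 'a list set" where
  "closed_walks V Rs = (\<Union>v\<in>V. walks Rs v v)"

lemma card_closed_walks:
  assumes "finite V" and "\<And>R x y. R \<in> set Rs \<Longrightarrow> R x y \<Longrightarrow> x \<in> V \<and> y \<in> V"
  shows "finite (closed_walks V Rs)" "real (card (closed_walks V Rs)) = mtr V (mprod V (map bmat Rs))"
proof -
  have *: "finite (walks Rs v v)" "real (card (walks Rs v v)) = mprod V (map bmat Rs) v v"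
    if "v \<in> V" for v
    using card_walks[of V Rs v v] assms that by auto
  then show "finite (closed_walks V Rs)" unfolding closed_walks_def using assms(1) by auto
  have "card (closed_walks V Rs) = (\<Sum>v\<in>V. card (walks Rs v v))"
    unfolding closed_walks_def using assms(1) *
    by (intro card_UN_disjoint) (auto simp: walks_def)
  then show "real (card (closed_walks V Rs)) = mtr V (mprod V (map bmat Rs))"
    by (simp add: mtr_def *)
qed

section \<open>Traces in a coloured graph\<close>

locale colored_graph =
  fixes V :: "'a set" and E :: "'a set set" and c :: "'a set \<Rightarrow> 'c"
  assumes simple: "simple_graph V E" and proper: "proper_edge_coloring E c"
begin

abbreviation mult (infixr "\<odot>" 70) where "A \<odot> B \<equiv> mmul V A B"

definition adj :: "'a \<Rightarrow> 'a \<Rightarrow> bool" where "adj u v \<longleftrightarrow> {u, v} \<in> E"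

definition W :: "nat \<Rightarrow> 'a \<Rightarrow> 'a \<Rightarrow> real" where "W l = mpow V (bmat adj) l"

definition cadj :: "'c \<Rightarrow> 'a \<Rightarrow> 'a \<Rightarrow> bool" where
  "cadj \<gamma> u v \<longleftrightarrow> {u, v} \<in> E \<and> c {u, v} = \<gamma>"

definition deg :: "'a \<Rightarrow> real" where "deg u = (\<Sum>w\<in>V. bmat adj u w)"

lemma finV: "finite V" using simple by (simp add: simple_graph_def)

lemma finE: "finite E"
  using simple finV finite_imp_finite_nsets finite_subset unfolding simple_graph_def by blast

lemma edge_in_V: "{u, v} \<in> E \<Longrightarrow> u \<in> V \<and> v \<in> V \<and> u \<noteq> v"
  using simple unfolding simple_graph_def by (metis doubleton_in_nsets_2 subsetD)

lemma supported_adj: "supported V (bmat adj)"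
  by (auto simp: supported_def bmat_def adj_def dest: edge_in_V)

lemma supported_cadj: "supported V (bmat (cadj \<gamma>))"
  by (auto simp: supported_def bmat_def cadj_def dest: edge_in_V)

lemma supported_W: "supported V (W l)"
  unfolding W_def by (intro supported_mprod) (auto simp: supported_adj)

lemma adj_sym: "bmat adj u v = bmat adj v u"
  by (simp add: bmat_def adj_def insert_commute)

lemma cadj_sym: "bmat (cadj \<gamma>) u v = bmat (cadj \<gamma>) v u"
  by (simp add: bmat_def cadj_def insert_commute)

lemma W_add: "W (a + b) = W a \<odot> W b"
  by (simp only: W_def replicate_add) (intro mprod_append finV, auto simp: supported_adj)

lemma W_0: "W 0 = mid V" by (simp add: W_def)

lemma W_1: "W 1 = bmat adj" by (simp add: W_def mmul_mid_right finV supported_adj)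

lemma W_sym: "W l u v = W l v u"
proof (induction l arbitrary: u v)
  case 0
  then show ?case by (auto simp: W_0 mid_def)
next
  case (Suc l)
  have "W (Suc l) u v = (W l \<odot> W 1) u v"
    using W_add[of l 1] by simp
  also have "\<dots> = (W 1 \<odot> W l) v u"
    unfolding mmul_def W_1 by (intro sum.cong) (auto simp: Suc adj_sym[of _ v])
  also have "\<dots> = W (Suc l) v u"
    using W_add[of 1 l] by simp
  finally show ?case .
qed

lemma W_nonneg: "0 \<le> W l u v"
  unfolding W_def by (induction l arbitrary: u v) (auto simp: mid_def mmul_def bmat_def intro!: sum_nonneg)

lemma W_Suc: "W (Suc l) = bmat adj \<odot> W l" by (simp add: W_def)

text \<open>Symmetry turns an entry into an inner product of two rows, the form to which
  Cauchy-Schwarz applies.\<close>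

lemma W_split: "W (a + b) u v = (\<Sum>w\<in>V. W a u w * W b v w)"
  unfolding W_add mmul_def by (simp add: W_sym[of _ v])

lemma W_2_diag: "W 2 v v = deg v"
proof -
  have "W 2 v v = (\<Sum>w\<in>V. bmat adj v w * bmat adj v w)"
    using W_split[of 1 1 v v] unfolding W_1 by (simp add: numeral_2_eq_2)
  also have "\<dots> = deg v" unfolding deg_def by (intro sum.cong) (auto simp: bmat_def)
  finally show ?thesis .
qed

text \<open>
  If \<open>W 1\<close> were positive semidefinite, the trace on the left would be a convex function of \<open>a\<close>,
  symmetric about \<open>s\<close>. Splitting both powers of \<open>W\<close> in two and applying Cauchy-Schwarz avoids
  the spectral decomposition.
\<close>

lemma trace_matching_power_le:
  assumes N: "\<And>u v. N u v = N v u" "supported V N" and a: "a \<le> 2 * s"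
  shows "mtr V (N \<odot> W a \<odot> N \<odot> W (2 * s - a)) \<le> mtr V ((N \<odot> N) \<odot> W (2 * s))"
proof -
  define F where "F = (\<lambda>a. mtr V (N \<odot> W a \<odot> N \<odot> W (2 * s - a)))"
  \<comment> \<open>The cyclic word \<open>N\<close>, \<open>W (p + q)\<close>, \<open>N\<close>,
    \<open>W (2 * s - (p + q))\<close> is cut inside both powers of \<open>W\<close> into
    \<open>X (s - p) p\<close> and \<open>X q (s - q)\<close>. Each piece combined with its
    transpose closes up to such a word again, of value \<open>F (2 * p)\<close> or
    \<open>F (2 * q)\<close>.\<close>
  define X where "X = (\<lambda>x p. W x \<odot> N \<odot> W p)"
  have WT: "(\<lambda>u v. W l v u) = W l" for l by (intro ext) (rule W_sym)
  have NT: "(\<lambda>u v. N v u) = N" by (intro ext) (rule N)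
  have XT: "(\<lambda>u v. X x p v u) = X p x" for x p
    by (simp only: X_def mmul_transpose WT NT mmul_assoc)
  have tr: "mtr V (X x p \<odot> X q y) = mtr V (N \<odot> W (p + q) \<odot> N \<odot> W (y + x))" for x p q y
  proof -
    have "mtr V (X x p \<odot> X q y) = mtr V (W x \<odot> (N \<odot> W (p + q) \<odot> N \<odot> W y))"
      by (simp only: X_def W_add mmul_assoc)
    also have "\<dots> = mtr V (N \<odot> W (p + q) \<odot> N \<odot> W (y + x))"
      by (subst mtr_mmul_commute) (simp only: W_add mmul_assoc)
    finally show ?thesis .
  qed
  have tr2: "mtr V (X (s - p) p \<odot> X p (s - p)) = F (2 * p)" if "p \<le> s" for p
    using that by (simp only: tr F_def) (simp add: mult_2 flip: diff_diff_left)
  have "F a \<le> F 0"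
  proof (rule symmetric_log_convex_le[where s = s])
    fix a assume "a \<le> 2 * s"
    then show "F (2 * s - a) = F a"
      unfolding F_def using mtr_mmul_commute[of V "N \<odot> W (2 * s - a)" "N \<odot> W a"]
      by (simp add: mmul_assoc)
  next
    fix p q assume pq: "p \<le> s" "q \<le> s"
    have "s - q + (s - p) = 2 * s - (p + q)" using pq by simp
    then have "F (p + q) = mtr V (X (s - p) p \<odot> X q (s - q))"
      unfolding tr F_def by (simp only:)
    then show "(F (p + q))\<^sup>2 \<le> F (2 * p) * F (2 * q)"
      using mtr_Cauchy_Schwarz[OF finV, of "X (s - p) p" "X q (s - q)"] tr2 pq
      by (simp add: XT)
  next
    fix p assume "p \<le> s"
    then have "F (2 * p) = mtr V (X (s - p) p \<odot> (\<lambda>u v. X (s - p) p v u))"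
      by (simp add: XT tr2)
    also have "\<dots> \<ge> 0" unfolding mtr_def mmul_def by (intro sum_nonneg) auto
    finally show "0 \<le> F (2 * p)" .
  qed (rule a)
  then show ?thesis
    by (simp add: F_def W_0 mmul_assoc mmul_mid_left finV supported_mmul N supported_W)
qed

text \<open>A colour class of a proper colouring is a matching, so the square of its matrix is
  diagonal. Over all colours, the diagonal entries at \<open>u\<close> add up to
  \<open>deg u\<close>.\<close>

lemma sum_trace_color_le:
  assumes a: "a \<le> 2 * s" and D: "\<And>u. u \<in> V \<Longrightarrow> deg u \<le> D"
  shows "(\<Sum>\<gamma>\<in>c ` E. mtr V (bmat (cadj \<gamma>) \<odot> W a \<odot> bmat (cadj \<gamma>) \<odot> W (2 * s - a)))
    \<le> D * mtr V (W (2 * s))"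
proof -
  let ?d = "\<lambda>\<gamma> u. \<Sum>w\<in>V. bmat (cadj \<gamma>) u w"
  have sq: "(bmat (cadj \<gamma>) \<odot> bmat (cadj \<gamma>)) u v = (if u = v then ?d \<gamma> u else 0)" for \<gamma> u v
  proof (cases "u = v")
    case True
    have "bmat (cadj \<gamma>) u w * bmat (cadj \<gamma>) w u = bmat (cadj \<gamma>) u w" for w
      unfolding cadj_sym[of \<gamma> w u] by (simp add: bmat_def)
    then show ?thesis unfolding mmul_def True[symmetric] by (simp only: if_True refl)
  next
    case False
    \<comment> \<open>A nonzero off-diagonal entry would need two edges of one colour meeting at
      \<open>w\<close>.\<close>
    have "\<not> (cadj \<gamma> u w \<and> cadj \<gamma> w v)" for w
    proof
      assume "cadj \<gamma> u w \<and> cadj \<gamma> w v"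
      then have "{u, w} \<in> E" "{w, v} \<in> E" "c {u, w} = c {w, v}" by (auto simp: cadj_def)
      moreover have "{u, w} \<noteq> {w, v}" using False by (auto simp: doubleton_eq_iff)
      moreover have "{u, w} \<inter> {w, v} \<noteq> {}" by auto
      ultimately show False using proper unfolding proper_edge_coloring_def by metis
    qed
    then show ?thesis using False unfolding mmul_def
      by (auto intro!: sum.neutral simp: bmat_def)
  qed
  have "mtr V ((bmat (cadj \<gamma>) \<odot> bmat (cadj \<gamma>)) \<odot> W (2 * s)) = (\<Sum>u\<in>V. ?d \<gamma> u * W (2 * s) u u)" for \<gamma>
  proof -
    have "((bmat (cadj \<gamma>) \<odot> bmat (cadj \<gamma>)) \<odot> W (2 * s)) u u = ?d \<gamma> u * W (2 * s) u u"
      if "u \<in> V" for u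
    proof -
      have "((bmat (cadj \<gamma>) \<odot> bmat (cadj \<gamma>)) \<odot> W (2 * s)) u u
          = (\<Sum>w\<in>V. if u = w then ?d \<gamma> u * W (2 * s) w u else 0)"
        unfolding mmul_def[of V "bmat (cadj \<gamma>) \<odot> bmat (cadj \<gamma>)"] sq by (intro sum.cong) auto
      then show ?thesis using that finV by simp
    qed
    then show ?thesis unfolding mtr_def by (intro sum.cong) auto
  qed
  then have "mtr V (bmat (cadj \<gamma>) \<odot> W a \<odot> bmat (cadj \<gamma>) \<odot> W (2 * s - a))
    \<le> (\<Sum>u\<in>V. ?d \<gamma> u * W (2 * s) u u)" for \<gamma>
    using trace_matching_power_le[OF cadj_sym supported_cadj a, of \<gamma>] by (simp only:)
  then have "(\<Sum>\<gamma>\<in>c ` E. mtr V (bmat (cadj \<gamma>) \<odot> W a \<odot> bmat (cadj \<gamma>) \<odot> W (2 * s - a)))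
    \<le> (\<Sum>\<gamma>\<in>c ` E. \<Sum>u\<in>V. ?d \<gamma> u * W (2 * s) u u)"
    by (intro sum_mono)
  also have "\<dots> = (\<Sum>u\<in>V. \<Sum>\<gamma>\<in>c ` E. ?d \<gamma> u * W (2 * s) u u)"
    by (rule sum.swap)
  also have "\<dots> = (\<Sum>u\<in>V. deg u * W (2 * s) u u)"
  proof (rule sum.cong)
    fix u
    have "(\<Sum>\<gamma>\<in>c ` E. ?d \<gamma> u) = (\<Sum>w\<in>V. \<Sum>\<gamma>\<in>c ` E. bmat (cadj \<gamma>) u w)"
      by (rule sum.swap)
    also have "\<dots> = (\<Sum>w\<in>V. bmat adj u w)"
    proof (rule sum.cong)
      fix w
      have "(\<Sum>\<gamma>\<in>c ` E. bmat (cadj \<gamma>) u w)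
          = (\<Sum>\<gamma>\<in>c ` E. if c {u, w} = \<gamma> then bmat adj u w else 0)"
        by (intro sum.cong) (auto simp: bmat_def cadj_def adj_def)
      also have "\<dots> = (if c {u, w} \<in> c ` E then bmat adj u w else 0)"
        using finE by (intro sum.delta') simp
      also have "\<dots> = bmat adj u w" by (auto simp: bmat_def adj_def)
      finally show "(\<Sum>\<gamma>\<in>c ` E. bmat (cadj \<gamma>) u w) = bmat adj u w" .
    qed simp
    finally have "(\<Sum>\<gamma>\<in>c ` E. ?d \<gamma> u) = deg u" by (simp only: deg_def)
    then show "(\<Sum>\<gamma>\<in>c ` E. ?d \<gamma> u * W (2 * s) u u) = deg u * W (2 * s) u u"
      by (metis (no_types) sum_distrib_right)
  qed simp
  also have "\<dots> \<le> (\<Sum>u\<in>V. D * W (2 * s) u u)"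
    using D W_nonneg by (intro sum_mono mult_right_mono) auto
  finally show ?thesis by (simp add: mtr_def sum_distrib_left)
qed

section \<open>Closed walks that visit a vertex twice\<close>

definition vadj :: "'a \<Rightarrow> 'a \<Rightarrow> 'a \<Rightarrow> bool" where
  "vadj v u w \<longleftrightarrow> u = v \<and> {u, w} \<in> E"

text \<open>Such a walk is at \<open>v\<close> twice and splits there into two closed walks of
  lengths \<open>Suc a\<close> and \<open>Suc b\<close>.\<close>

lemma trace_vertex:
  assumes v: "v \<in> V"
  shows "mtr V (bmat (vadj v) \<odot> W a \<odot> bmat (vadj v) \<odot> W b) = W (Suc a) v v * W (Suc b) v v"
proof -
  have *: "(bmat (vadj v) \<odot> W a) u w = (if u = v then W (Suc a) v w else 0)" for u w a
    by (auto simp: W_Suc mmul_def bmat_def vadj_def adj_def)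
  have "mtr V (bmat (vadj v) \<odot> W a \<odot> bmat (vadj v) \<odot> W b)
      = mtr V ((bmat (vadj v) \<odot> W a) \<odot> (bmat (vadj v) \<odot> W b))"
    by (simp only: mmul_assoc)
  also have "\<dots> = (\<Sum>u\<in>V. if u = v then \<Sum>w\<in>V. if w = v then W (Suc a) v w * W (Suc b) v u else 0 else 0)"
    unfolding mtr_def mmul_def[of V "_ \<odot> _"] * by (intro sum.cong) (auto intro!: sum.cong)
  also have "\<dots> = W (Suc a) v v * W (Suc b) v v"
    using v finV by simp
  finally show ?thesis .
qed

text \<open>Log-convexity favours the most uneven split of the total length \<open>2 * s + 2\<close>
  into two closed walks at \<open>v\<close> of length at least 2: lengths 2 and
  \<open>2 * s\<close>, where the short one contributes \<open>deg v\<close>.\<close>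

lemma closed_walk_split_le:
  assumes ab: "a + b = 2 * s" and s: "1 \<le> s" and v: "v \<in> V"
  shows "W (Suc a) v v * W (Suc b) v v \<le> deg v * W (2 * s) v v"
proof (cases "a = 0 \<or> b = 0")
  case True
  \<comment> \<open>A closed walk of length 1 would be a loop.\<close>
  have "W (Suc 0) v v = 0" using edge_in_V[of v v] W_1 unfolding One_nat_def by (simp add: bmat_def adj_def) blast
  moreover have "0 \<le> deg v * W (2 * s) v v"
    by (metis W_2_diag W_nonneg mult_nonneg_nonneg)
  ultimately show ?thesis using True by auto
next
  case False
  \<comment> \<open>The argument is the length of the first part minus 2, so that \<open>0\<close>
    stands for the extreme split and \<open>a - 1\<close> for the given one.\<close>
  define F where "F = (\<lambda>x. W (x + 2) v v * W (2 * (s - 1) - x + 2) v v)"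
  have sq: "(W (p + q + 2) v v)\<^sup>2 \<le> W (2 * p + 2) v v * W (2 * q + 2) v v" for p q
  proof -
    have e: "p + q + 2 = (p + 1) + (q + 1)" "2 * p + 2 = (p + 1) + (p + 1)"
      "2 * q + 2 = (q + 1) + (q + 1)" by simp_all
    show ?thesis
      unfolding e W_split[of "p + 1" "q + 1"] W_split[of "p + 1" "p + 1"] W_split[of "q + 1" "q + 1"]
      using Cauchy_Schwarz_ineq_sum[of "W (p + 1) v" "W (q + 1) v" V]
      by (simp only: power2_eq_square)
  qed
  have "F (a - 1) \<le> F 0"
  proof (rule symmetric_log_convex_le[where s = "s - 1"])
    fix x assume "x \<le> 2 * (s - 1)"
    then show "F (2 * (s - 1) - x) = F x" by (simp add: F_def)
  next
    fix p q assume pq: "p \<le> s - 1" "q \<le> s - 1"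
    have "(F (p + q))\<^sup>2 = (W (p + q + 2) v v)\<^sup>2 * (W ((s - 1 - p) + (s - 1 - q) + 2) v v)\<^sup>2"
    proof -
      have "2 * (s - 1) - (p + q) + 2 = (s - 1 - p) + (s - 1 - q) + 2" using pq by linarith
      then show ?thesis unfolding F_def power_mult_distrib by (simp only:)
    qed
    also have "\<dots> \<le> (W (2 * p + 2) v v * W (2 * q + 2) v v)
        * (W (2 * (s - 1 - p) + 2) v v * W (2 * (s - 1 - q) + 2) v v)"
      by (intro mult_mono sq) (auto simp: W_nonneg)
    also have "\<dots> = F (2 * p) * F (2 * q)"
      unfolding F_def by (simp add: diff_mult_distrib2)
    finally show "(F (p + q))\<^sup>2 \<le> F (2 * p) * F (2 * q)" .
  next
    show "0 \<le> F (2 * p)" for p unfolding F_def by (intro mult_nonneg_nonneg W_nonneg)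
    show "a - 1 \<le> 2 * (s - 1)" using ab False by linarith
  qed
  moreover have "F (a - 1) = W (Suc a) v v * W (Suc b) v v"
  proof -
    have "a - 1 + 2 = Suc a" "2 * (s - 1) - (a - 1) + 2 = Suc b" using ab False s by linarith+
    then show ?thesis unfolding F_def by (simp only:)
  qed
  moreover have "F 0 = deg v * W (2 * s) v v"
  proof -
    have "2 * (s - 1) - 0 + 2 = 2 * s" "0 + 2 = (2::nat)" using s by simp_all
    then show ?thesis unfolding F_def by (simp only: W_2_diag)
  qed
  ultimately show ?thesis by simp
qed

lemma sum_trace_vertex_le:
  assumes "a \<le> 2 * s" and "1 \<le> s" and D: "\<And>u. u \<in> V \<Longrightarrow> deg u \<le> D"
  shows "(\<Sum>v\<in>V. mtr V (bmat (vadj v) \<odot> W a \<odot> bmat (vadj v) \<odot> W (2 * s - a)))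
    \<le> D * mtr V (W (2 * s))"
proof -
  have "(\<Sum>v\<in>V. mtr V (bmat (vadj v) \<odot> W a \<odot> bmat (vadj v) \<odot> W (2 * s - a)))
      \<le> (\<Sum>v\<in>V. D * W (2 * s) v v)"
  proof (rule sum_mono)
    fix v assume v: "v \<in> V"
    have "W (Suc a) v v * W (Suc (2 * s - a)) v v \<le> deg v * W (2 * s) v v"
      using assms v by (intro closed_walk_split_le) auto
    also have "\<dots> \<le> D * W (2 * s) v v"
      using D v W_nonneg by (intro mult_right_mono) auto
    finally show "mtr V (bmat (vadj v) \<odot> W a \<odot> bmat (vadj v) \<odot> W (2 * s - a))
      \<le> D * W (2 * s) v v" by (simp only: trace_vertex[OF v])
  qed
  then show ?thesis by (simp add: mtr_def sum_distrib_left)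
qed

section \<open>Degenerate closed walks\<close>

definition pattern :: "nat \<Rightarrow> ('a \<Rightarrow> 'a \<Rightarrow> bool) \<Rightarrow> nat \<Rightarrow> nat \<Rightarrow> ('a \<Rightarrow> 'a \<Rightarrow> bool) list" where
  "pattern l R i j = replicate i adj @ R # replicate (j - i - 1) adj @ R # replicate (l - j - 1) adj"

lemma length_pattern: "i < j \<Longrightarrow> j < l \<Longrightarrow> length (pattern l R i j) = l"
  by (simp add: pattern_def)

lemma nth_pattern:
  "i < j \<Longrightarrow> j < l \<Longrightarrow> t < l \<Longrightarrow> pattern l R i j ! t = (if t = i \<or> t = j then R else adj)"
  by (auto simp: pattern_def nth_append nth_Cons')

lemma closed_walks_adj_iff:
  assumes "0 < l"
  shows "xs \<in> closed_walks V (replicate l adj) \<longleftrightarrow>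
    length xs = Suc l \<and> xs ! l = xs ! 0 \<and> (\<forall>t<l. {xs ! t, xs ! Suc t} \<in> E)"
  (is "_ \<longleftrightarrow> ?R")
proof
  assume ?R
  then have "xs ! 0 \<in> V" using assms edge_in_V by blast
  then show "xs \<in> closed_walks V (replicate l adj)"
    using \<open>?R\<close> by (simp add: closed_walks_def walks_def adj_def)
qed (auto simp: closed_walks_def walks_def adj_def)

lemma closed_walks_patternI:
  assumes "xs \<in> closed_walks V (replicate l adj)" "i < j" "j < l"
    and "R (xs ! i) (xs ! Suc i)" "R (xs ! j) (xs ! Suc j)"
  shows "xs \<in> closed_walks V (pattern l R i j)"
  using assms unfolding closed_walks_def walks_def
  by (auto simp: length_pattern nth_pattern)

text \<open>By cyclicity of the trace, the steps after \<open>j\<close> and those before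
  \<open>i\<close> merge into one power of \<open>W\<close>; the two \<open>R\<close> steps account
  for the 2 in the exponent.\<close>

lemma card_closed_walks_pattern:
  assumes "i < j" "j < l" and R: "\<And>x y. R x y \<Longrightarrow> x \<in> V \<and> y \<in> V"
  shows "real (card (closed_walks V (pattern l R i j)))
    = mtr V (bmat R \<odot> W (j - i - 1) \<odot> bmat R \<odot> W (l - 2 - (j - i - 1)))"
proof -
  have Rs: "\<And>Q x y. Q \<in> set (pattern l R i j) \<Longrightarrow> Q x y \<Longrightarrow> x \<in> V \<and> y \<in> V"
    using R by (auto simp: pattern_def adj_def dest: edge_in_V)
  have suppR: "supported V (bmat R)" using R by (auto simp: supported_def bmat_def)
  have "mprod V (map bmat (pattern l R i j))
      = W i \<odot> (bmat R \<odot> W (j - i - 1) \<odot> bmat R \<odot> W (l - j - 1))"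
  proof -
    have app: "mprod V (replicate m (bmat adj) @ bmat R # Bs) = W m \<odot> bmat R \<odot> mprod V Bs"
      if "\<forall>B\<in>set Bs. supported V B" for m Bs
      using that suppR by (subst mprod_append) (auto simp: finV W_def)
    have "mprod V (map bmat (pattern l R i j))
        = W i \<odot> bmat R \<odot> mprod V (replicate (j - i - 1) (bmat adj) @ bmat R # replicate (l - j - 1) (bmat adj))"
      unfolding pattern_def using suppR supported_adj by (simp, subst app) auto
    then show ?thesis
      using supported_adj by (simp add: app) (simp add: W_def)
  qed
  then have "real (card (closed_walks V (pattern l R i j)))
      = mtr V ((bmat R \<odot> W (j - i - 1) \<odot> bmat R \<odot> W (l - j - 1)) \<odot> W i)"
    using card_closed_walks(2)[OF finV Rs] by (simp add: mtr_mmul_commute)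
  also have "\<dots> = mtr V (bmat R \<odot> W (j - i - 1) \<odot> bmat R \<odot> W (l - j - 1 + i))"
    by (simp only: mmul_assoc W_add)
  also have "l - j - 1 + i = l - 2 - (j - i - 1)" using assms by simp
  finally show ?thesis .
qed

lemma closed_walk_gives_rainbow_cycle:
  assumes k: "2 \<le> k" and xs: "xs \<in> closed_walks V (replicate (2 * k) adj)"
    and dist: "\<And>i j. i < j \<Longrightarrow> j < 2 * k \<Longrightarrow> xs ! i \<noteq> xs ! j"
    and col: "\<And>i j. i < j \<Longrightarrow> j < 2 * k \<Longrightarrow> c {xs ! i, xs ! Suc i} \<noteq> c {xs ! j, xs ! Suc j}"
  shows "\<exists>C. C \<subseteq> E \<and> is_cycle (2 * k) C \<and> rainbow c C"
proof -
  define vs where "vs = take (2 * k) xs"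
  have x: "length xs = Suc (2 * k)" "xs ! (2 * k) = xs ! 0"
    "\<And>t. t < 2 * k \<Longrightarrow> {xs ! t, xs ! Suc t} \<in> E"
    using xs k by (auto simp: closed_walks_adj_iff)
  have len: "length vs = 2 * k" using x by (simp add: vs_def)
  have dvs: "distinct vs"
    unfolding distinct_conv_nth len
  proof (intro allI impI)
    fix i j assume "i < 2 * k" "j < 2 * k" "i \<noteq> j"
    then show "vs ! i \<noteq> vs ! j"
      using dist[of i j] dist[of j i] by (cases i j rule: linorder_cases) (auto simp: vs_def)
  qed
  \<comment> \<open>At the last index the successor wraps around to \<open>vs ! 0\<close>, which
    equals the dropped entry \<open>xs ! (2 * k)\<close>.\<close>
  have nxt: "{vs ! i, vs ! (Suc i mod length vs)} = {xs ! i, xs ! Suc i}" if "i < 2 * k" for i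
  proof (cases "Suc i = 2 * k")
    case True
    then show ?thesis using that x len k by (simp add: vs_def)
  next
    case False
    then show ?thesis using that x len by (simp add: vs_def)
  qed
  have C: "cycle_edges vs = (\<lambda>i. {xs ! i, xs ! Suc i}) ` {..<2 * k}"
  proof -
    have "cycle_edges vs = (\<lambda>i. {vs ! i, vs ! (Suc i mod length vs)}) ` {..<2 * k}"
      unfolding cycle_edges_def len by auto
    also have "\<dots> = (\<lambda>i. {xs ! i, xs ! Suc i}) ` {..<2 * k}"
      by (intro image_cong refl nxt) simp
    finally show ?thesis .
  qed
  have "rainbow c (cycle_edges vs)"
    unfolding rainbow_def C
  proof (intro inj_onI)
    fix e f
    assume "e \<in> (\<lambda>i. {xs ! i, xs ! Suc i}) ` {..<2 * k}" "f \<in> (\<lambda>i. {xs ! i, xs ! Suc i}) ` {..<2 * k}"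
      and cef: "c e = c f"
    then obtain i j where "i < 2 * k" "j < 2 * k" "e = {xs ! i, xs ! Suc i}" "f = {xs ! j, xs ! Suc j}"
      by auto
    then show "e = f" using col[of i j] col[of j i] cef by (cases i j rule: linorder_cases) auto
  qed
  moreover have "cycle_edges vs \<subseteq> E" unfolding C using x by auto
  moreover have "is_cycle (2 * k) (cycle_edges vs)"
    unfolding is_cycle_def using k len dvs by auto
  ultimately show ?thesis by blast
qed

text \<open>The factor 8 comes from at most \<open>4 * k\<^sup>2\<close> pairs of positions and two
  kinds of repetition, vertex or colour, each accounting for at most \<open>?T\<close>
  walks.\<close>

lemma trace_le_if_no_rainbow_cycle:
  assumes k: "2 \<le> k" and D: "\<And>u. u \<in> V \<Longrightarrow> deg u \<le> D"
    and no: "\<not> (\<exists>C. C \<subseteq> E \<and> is_cycle (2 * k) C \<and> rainbow c C)"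
  shows "mtr V (W (2 * k)) \<le> 8 * (real k)\<^sup>2 * D * mtr V (W (2 * (k - 1)))"
proof -
  define P where "P = {(i, j). i < j \<and> j < 2 * k}"
  define Bv where "Bv = (\<lambda>(i, j). \<Union>v\<in>V. closed_walks V (pattern (2 * k) (vadj v) i j))"
  define Bc where "Bc = (\<lambda>(i, j). \<Union>\<gamma>\<in>c ` E. closed_walks V (pattern (2 * k) (cadj \<gamma>) i j))"
  let ?T = "D * mtr V (W (2 * (k - 1)))"
  have vV: "vadj v x y \<Longrightarrow> x \<in> V \<and> y \<in> V" for v x y by (auto simp: vadj_def dest: edge_in_V)
  have cV: "cadj \<gamma> x y \<Longrightarrow> x \<in> V \<and> y \<in> V" for \<gamma> x y by (auto simp: cadj_def dest: edge_in_V)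
  have aV: "\<And>R x y. R \<in> set (replicate l adj) \<Longrightarrow> R x y \<Longrightarrow> x \<in> V \<and> y \<in> V" for l
    by (auto simp: adj_def dest: edge_in_V split: if_splits)
  have k2: "2 * k - 2 = 2 * (k - 1)" by simp
  have Psub: "P \<subseteq> {..<2 * k} \<times> {..<2 * k}" unfolding P_def by auto
  then have finP: "finite P" by (rule finite_subset) auto
  have "card P \<le> card ({..<2 * k} \<times> {..<2 * k})" using Psub by (intro card_mono) auto
  then have cardP: "card P \<le> 4 * k\<^sup>2" by (simp add: power2_eq_square)
  have fin_pat: "finite (closed_walks V (pattern (2 * k) R i j))"
    if "\<And>x y. R x y \<Longrightarrow> x \<in> V \<and> y \<in> V" for R i j
    using that by (intro card_closed_walks(1) finV) (auto simp: pattern_def adj_def dest: edge_in_V)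
  have Bv: "real (card (Bv p)) \<le> ?T" and Bc: "real (card (Bc p)) \<le> ?T" if "p \<in> P" for p
  proof -
    obtain i j where p: "p = (i, j)" "i < j" "j < 2 * k" using \<open>p \<in> P\<close> unfolding P_def by auto
    let ?a = "j - i - 1"
    have a: "?a \<le> 2 * (k - 1)" using p by simp
    have "real (card (Bv p)) \<le> (\<Sum>v\<in>V. real (card (closed_walks V (pattern (2 * k) (vadj v) i j))))"
      unfolding Bv_def p using card_UN_le[OF finV] by (simp flip: of_nat_sum)
    also have "\<dots> = (\<Sum>v\<in>V. mtr V (bmat (vadj v) \<odot> W ?a \<odot> bmat (vadj v) \<odot> W (2 * (k - 1) - ?a)))"
      using card_closed_walks_pattern[OF p(2,3) vV] by (simp only: k2)
    also have "\<dots> \<le> ?T"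
      using sum_trace_vertex_le[OF a _ D] k by simp
    finally show "real (card (Bv p)) \<le> ?T" .
    have "real (card (Bc p)) \<le> (\<Sum>\<gamma>\<in>c ` E. real (card (closed_walks V (pattern (2 * k) (cadj \<gamma>) i j))))"
      unfolding Bc_def p using card_UN_le[OF finite_imageI[OF finE]] by (simp flip: of_nat_sum)
    also have "\<dots> = (\<Sum>\<gamma>\<in>c ` E. mtr V (bmat (cadj \<gamma>) \<odot> W ?a \<odot> bmat (cadj \<gamma>) \<odot> W (2 * (k - 1) - ?a)))"
      using card_closed_walks_pattern[OF p(2,3) cV] by (simp only: k2)
    also have "\<dots> \<le> ?T"
      using sum_trace_color_le[OF a D] by simp
    finally show "real (card (Bc p)) \<le> ?T" .
  qed
  have sub: "closed_walks V (replicate (2 * k) adj) \<subseteq> (\<Union>p\<in>P. Bv p \<union> Bc p)"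
  proof
    fix xs assume xs: "xs \<in> closed_walks V (replicate (2 * k) adj)"
    have x: "\<And>t. t < 2 * k \<Longrightarrow> {xs ! t, xs ! Suc t} \<in> E"
      using xs k by (auto simp: closed_walks_adj_iff)
    obtain i j where ij: "i < j" "j < 2 * k"
      and bad: "xs ! i = xs ! j \<or> c {xs ! i, xs ! Suc i} = c {xs ! j, xs ! Suc j}"
      using closed_walk_gives_rainbow_cycle[OF k xs] no by blast
    from bad have "xs \<in> Bv (i, j) \<union> Bc (i, j)"
    proof
      assume "xs ! i = xs ! j"
      then have "xs \<in> closed_walks V (pattern (2 * k) (vadj (xs ! i)) i j)"
        using ij x[of i] x[of j] by (intro closed_walks_patternI[OF xs ij]) (simp_all add: vadj_def)
      moreover have "xs ! i \<in> V" using edge_in_V[OF x[of i]] ij by simp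
      ultimately show ?thesis unfolding Bv_def by auto
    next
      assume "c {xs ! i, xs ! Suc i} = c {xs ! j, xs ! Suc j}"
      then have "xs \<in> closed_walks V (pattern (2 * k) (cadj (c {xs ! i, xs ! Suc i})) i j)"
        using ij x by (intro closed_walks_patternI[OF xs ij]) (auto simp: cadj_def)
      moreover have "c {xs ! i, xs ! Suc i} \<in> c ` E" using x[of i] ij by simp
      ultimately show ?thesis unfolding Bc_def by auto
    qed
    then show "xs \<in> (\<Union>p\<in>P. Bv p \<union> Bc p)" using ij unfolding P_def by blast
  qed
  have finB: "finite (Bv p \<union> Bc p)" for p
    unfolding Bv_def Bc_def using fin_pat vV cV finV finE by (auto split: prod.splits)
  have "mtr V (W (2 * k)) = real (card (closed_walks V (replicate (2 * k) adj)))"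
  proof -
    have "real (card (closed_walks V (replicate (2 * k) adj)))
        = mtr V (mprod V (map bmat (replicate (2 * k) adj)))"
      by (rule card_closed_walks(2)[OF finV aV])
    then show ?thesis by (simp add: W_def)
  qed
  also have "\<dots> \<le> real (card (\<Union>p\<in>P. Bv p \<union> Bc p))"
    using sub finP finB by (intro of_nat_mono card_mono) auto
  also have "\<dots> \<le> real (\<Sum>p\<in>P. card (Bv p \<union> Bc p))"
    by (intro of_nat_mono card_UN_le finP)
  also have "\<dots> \<le> real (\<Sum>p\<in>P. card (Bv p) + card (Bc p))"
    by (intro of_nat_mono sum_mono card_Un_le)
  also have "\<dots> = (\<Sum>p\<in>P. real (card (Bv p)) + real (card (Bc p)))"
    by simp
  also have "\<dots> \<le> (\<Sum>p\<in>P. ?T + ?T)"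
    using Bv Bc by (intro sum_mono add_mono)
  also have "\<dots> = real (card P) * (2 * ?T)" by simp
  \<comment> \<open>Enlarging the count of pairs needs \<open>?T\<close> to be nonnegative; it is,
    since it bounds a cardinality for any pair in \<open>P\<close>, and \<open>(0, 1)\<close> is
    one.\<close>
  also have "\<dots> \<le> real (4 * k\<^sup>2) * (2 * ?T)"
  proof (cases "P = {}")
    case True
    have "(0, 1) \<in> P" using k by (simp add: P_def)
    then show ?thesis using True by simp
  next
    case False
    then obtain p where "p \<in> P" by blast
    then have "0 \<le> ?T" using Bv[of p] of_nat_0_le_iff order_trans by blast
    then show ?thesis using cardP by (intro mult_right_mono of_nat_mono) auto
  qed
  finally show ?thesis by simp
qed

section \<open>Graphs with a vertex cover\<close>

lemma deg_eq_card: "deg u = real (card {w \<in> V. {u, w} \<in> E})"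
  unfolding deg_def bmat_def adj_def using finV by (simp add: of_bool_def sum.If_cases Int_def)

lemma edge_pair:
  assumes "e \<in> E"
  shows "\<exists>x y. e = {x, y} \<and> x \<in> V \<and> y \<in> V"
proof -
  have "e \<in> nsets V 2" using assms simple unfolding simple_graph_def by blast
  then show ?thesis by (auto simp: nsets_def card_2_iff)
qed

lemma card_edges_le_sum_deg_cover:
  assumes B: "B \<subseteq> V" and cover: "\<And>e. e \<in> E \<Longrightarrow> e \<inter> B \<noteq> {}"
  shows "real (card E) \<le> (\<Sum>u\<in>B. deg u)"
proof -
  let ?N = "\<lambda>u. {w \<in> V. {u, w} \<in> E}"
  have finB: "finite B" using B finV finite_subset by blast
  have "E \<subseteq> (\<Union>u\<in>B. (\<lambda>w. {u, w}) ` ?N u)"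
  proof
    fix e assume e: "e \<in> E"
    then obtain x y where xy: "e = {x, y}" "x \<in> V" "y \<in> V"
      using edge_pair by blast
    have "x \<in> B \<or> y \<in> B" using cover[OF e] xy by auto
    then obtain u w where "u \<in> B" "w \<in> V" "e = {u, w}" using xy by blast
    then show "e \<in> (\<Union>u\<in>B. (\<lambda>w. {u, w}) ` ?N u)" using e by auto
  qed
  then have "card E \<le> card (\<Union>u\<in>B. (\<lambda>w. {u, w}) ` ?N u)"
    using finB finV by (intro card_mono) auto
  also have "\<dots> \<le> (\<Sum>u\<in>B. card ((\<lambda>w. {u, w}) ` ?N u))"
    by (rule card_UN_le[OF finB])
  also have "\<dots> \<le> (\<Sum>u\<in>B. card (?N u))"
    using finV by (intro sum_mono card_image_le) auto
  finally show ?thesis by (simp add: deg_eq_card flip: of_nat_sum)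
qed

text \<open>Each edge comes from at most two ordered pairs of endpoints.\<close>

lemma sum_deg_le: "(\<Sum>v\<in>V. deg v) \<le> 2 * real (card E)"
proof -
  have "(\<Sum>v\<in>V. card {w \<in> V. {v, w} \<in> E}) = card (SIGMA v:V. {w \<in> V. {v, w} \<in> E})"
    using finV by simp
  also have "\<dots> \<le> card (\<Union>e\<in>E. {(v, w). {v, w} = e})"
  proof (rule card_mono)
    have "(\<Union>e\<in>E. {(v, w). {v, w} = e}) \<subseteq> V \<times> V"
    proof clarify
      fix v w assume "{v, w} \<in> E"
      then show "v \<in> V \<and> w \<in> V" using edge_in_V by blast
    qed
    then show "finite (\<Union>e\<in>E. {(v, w). {v, w} = e})"
      by (rule finite_subset) (simp add: finV)
    show "(SIGMA v:V. {w \<in> V. {v, w} \<in> E}) \<subseteq> (\<Union>e\<in>E. {(v, w). {v, w} = e})"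
    proof
      fix p assume "p \<in> (SIGMA v:V. {w \<in> V. {v, w} \<in> E})"
      then have "{fst p, snd p} \<in> E" by (cases p) simp
      then show "p \<in> (\<Union>e\<in>E. {(v, w). {v, w} = e})"
        by (rule UN_I) (cases p, simp)
    qed
  qed
  also have "\<dots> \<le> (\<Sum>e\<in>E. card {(v, w). {v, w} = e})"
    by (rule card_UN_le[OF finE])
  also have "\<dots> \<le> (\<Sum>e\<in>E. 2)"
  proof (rule sum_mono)
    fix e assume e: "e \<in> E"
    then obtain x y where xy: "e = {x, y}" "x \<in> V" "y \<in> V"
      using edge_pair by blast
    have "{(v, w). {v, w} = e} \<subseteq> {(x, y), (y, x)}"
      unfolding xy(1) by (auto simp: doubleton_eq_iff)
    then have "card {(v, w). {v, w} = e} \<le> card {(x, y), (y, x)}" by (rule card_mono[rotated]) simp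
    also have "\<dots> \<le> 2" by (cases "x = y") simp_all
    finally show "card {(v, w). {v, w} = e} \<le> 2" .
  qed
  also have "\<dots> = 2 * card E" by simp
  finally have "real (\<Sum>v\<in>V. card {w \<in> V. {v, w} \<in> E}) \<le> real (2 * card E)"
    by (rule of_nat_mono)
  then show ?thesis unfolding deg_eq_card by simp
qed

section \<open>Traces and walk counts on a vertex cover\<close>

context
  fixes B :: "'a set"
  assumes B: "B \<subseteq> V" and cover: "\<And>e. e \<in> E \<Longrightarrow> e \<inter> B \<noteq> {}"
begin

definition cover_trace :: "nat \<Rightarrow> real" where
  "cover_trace j = (\<Sum>v\<in>B. W (2 * j) v v)"

text \<open>The quadratic form of \<open>W (2 * j)\<close> at the indicator vector of
  \<open>B\<close>. Like \<open>cover_trace\<close>, it starts at \<open>card B\<close> instead of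
  \<open>card V\<close>, which is where a small cover pays off.\<close>

definition cover_walks :: "nat \<Rightarrow> real" where
  "cover_walks j = (\<Sum>u\<in>B. \<Sum>v\<in>B. W (2 * j) u v)"

lemma finB: "finite B" using B finV finite_subset by blast

lemma cover_trace_0: "cover_trace 0 = real (card B)"
proof -
  have "cover_trace 0 = (\<Sum>v\<in>B. 1)"
    unfolding cover_trace_def using B by (intro sum.cong) (auto simp: W_0 mid_def)
  then show ?thesis by simp
qed

lemma cover_walks_0: "cover_walks 0 = real (card B)"
proof -
  have "(\<Sum>v\<in>B. W (2 * 0) u v) = 1" if "u \<in> B" for u
  proof -
    have "(\<Sum>v\<in>B. W (2 * 0) u v) = (\<Sum>v\<in>B. if u = v then 1 else 0)"
      using B that by (intro sum.cong) (auto simp: W_0 mid_def)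
    then show ?thesis using finB that by simp
  qed
  then show ?thesis unfolding cover_walks_def by simp
qed

lemma cover_trace_split:
  assumes "2 * j = a + b"
  shows "cover_trace j = (\<Sum>(v, w)\<in>B \<times> V. W a v w * W b v w)"
  unfolding cover_trace_def assms W_split by (simp add: sum.cartesian_product)

lemma cover_walks_split:
  assumes "2 * j = a + b"
  shows "cover_walks j = (\<Sum>w\<in>V. (\<Sum>u\<in>B. W a u w) * (\<Sum>u\<in>B. W b u w))"
proof -
  have "cover_walks j = (\<Sum>u\<in>B. \<Sum>v\<in>B. \<Sum>w\<in>V. W a u w * W b v w)"
    unfolding cover_walks_def assms W_split ..
  also have "\<dots> = (\<Sum>u\<in>B. \<Sum>w\<in>V. \<Sum>v\<in>B. W a u w * W b v w)"
    by (intro sum.cong refl sum.swap)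
  also have "\<dots> = (\<Sum>w\<in>V. \<Sum>u\<in>B. \<Sum>v\<in>B. W a u w * W b v w)"
    by (rule sum.swap)
  finally show ?thesis by (simp only: sum_product)
qed

lemma cover_trace_nonneg: "0 \<le> cover_trace j"
  unfolding cover_trace_def by (intro sum_nonneg W_nonneg)

lemma cover_walks_nonneg: "0 \<le> cover_walks j"
  unfolding cover_walks_def by (intro sum_nonneg W_nonneg)

text \<open>The middle length \<open>2 * Suc j\<close> is split as \<open>j + (j + 2)\<close>, the
  outer ones into halves \<open>j\<close> and \<open>j + 2\<close>; then this is
  Cauchy-Schwarz.\<close>

lemma cover_trace_log_convex:
  "(cover_trace (Suc j))\<^sup>2 \<le> cover_trace j * cover_trace (Suc (Suc j))"
proof -
  have "cover_trace (Suc j) = (\<Sum>(v, w)\<in>B \<times> V. W j v w * W (j + 2) v w)"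
    by (rule cover_trace_split) simp
  moreover have "cover_trace j = (\<Sum>(v, w)\<in>B \<times> V. (W j v w)\<^sup>2)"
    unfolding power2_eq_square by (rule cover_trace_split) simp
  moreover have "cover_trace (Suc (Suc j)) = (\<Sum>(v, w)\<in>B \<times> V. (W (j + 2) v w)\<^sup>2)"
    unfolding power2_eq_square by (rule cover_trace_split) simp
  ultimately show ?thesis
    using Cauchy_Schwarz_ineq_sum[of "\<lambda>(v, w). W j v w" "\<lambda>(v, w). W (j + 2) v w" "B \<times> V"]
    by (simp add: case_prod_beta)
qed

lemma cover_walks_log_convex:
  "(cover_walks (Suc j))\<^sup>2 \<le> cover_walks j * cover_walks (Suc (Suc j))"
proof -
  let ?f = "\<lambda>a w. \<Sum>u\<in>B. W a u w"
  have "cover_walks (Suc j) = (\<Sum>w\<in>V. ?f j w * ?f (j + 2) w)"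
    by (rule cover_walks_split) simp
  moreover have "cover_walks j = (\<Sum>w\<in>V. (?f j w)\<^sup>2)"
    unfolding power2_eq_square by (rule cover_walks_split) simp
  moreover have "cover_walks (Suc (Suc j)) = (\<Sum>w\<in>V. (?f (j + 2) w)\<^sup>2)"
    unfolding power2_eq_square by (rule cover_walks_split) simp
  ultimately show ?thesis
    using Cauchy_Schwarz_ineq_sum[of "?f j" "?f (j + 2)" V] by (simp only:)
qed

text \<open>The sum of all entries of a positive semidefinite matrix is at most its size times its trace.\<close>

lemma cover_walks_le_cover_trace: "cover_walks j \<le> real (card B) * cover_trace j"
proof -
  \<comment> \<open>The entry is the inner product of the rows \<open>u\<close> and \<open>v\<close>
    of \<open>W j\<close>, so it is at most the mean of their squared norms.\<close>
  have dom: "2 * W (2 * j) u v \<le> W (2 * j) u u + W (2 * j) v v" for u v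
  proof -
    have "(\<Sum>w\<in>V. 2 * (W j u w * W j v w)) \<le> (\<Sum>w\<in>V. W j u w * W j u w + W j v w * W j v w)"
    proof (rule sum_mono)
      fix w show "2 * (W j u w * W j v w) \<le> W j u w * W j u w + W j v w * W j v w"
        using sum_squares_bound[of "W j u w" "W j v w"] by (simp add: power2_eq_square)
    qed
    then show ?thesis
      unfolding mult_2[of j] W_split by (simp only: sum.distrib sum_distrib_left)
  qed
  have "2 * cover_walks j \<le> (\<Sum>u\<in>B. \<Sum>v\<in>B. W (2 * j) u u + W (2 * j) v v)"
    unfolding cover_walks_def sum_distrib_left by (intro sum_mono dom)
  also have "\<dots> = 2 * (real (card B) * cover_trace j)"
    unfolding cover_trace_def by (simp add: sum.distrib sum_distrib_left)
  finally show ?thesis by simp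
qed

text \<open>Cauchy-Schwarz over \<open>w\<close> in \<open>V\<close>, where \<open>?f w\<close> is
  the number of neighbours of \<open>w\<close> in \<open>B\<close>: these numbers sum to at least
  \<open>card E\<close>, and their squares count walks of length 2 with both ends in
  \<open>B\<close>.\<close>

lemma card_edges_sq_le: "(real (card E))\<^sup>2 \<le> real (card V) * cover_walks 1"
proof -
  let ?f = "\<lambda>w. \<Sum>u\<in>B. W 1 u w"
  have "(\<Sum>w\<in>V. ?f w) = (\<Sum>u\<in>B. deg u)"
    unfolding deg_def W_1 by (rule sum.swap)
  then have "real (card E) \<le> (\<Sum>w\<in>V. ?f w)"
    using card_edges_le_sum_deg_cover[OF B cover] by simp
  then have "(real (card E))\<^sup>2 \<le> (\<Sum>w\<in>V. 1 * ?f w)\<^sup>2"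
    by (intro power_mono) auto
  also have "\<dots> \<le> (\<Sum>w\<in>V. 1\<^sup>2) * (\<Sum>w\<in>V. (?f w)\<^sup>2)"
    by (rule Cauchy_Schwarz_ineq_sum)
  also have "(\<Sum>w\<in>V. (?f w)\<^sup>2) = cover_walks 1"
    unfolding power2_eq_square by (rule cover_walks_split[symmetric]) simp
  finally show ?thesis by simp
qed

text \<open>\<open>V - B\<close> is independent, so a closed walk from outside \<open>B\<close> has
  its second vertex in \<open>B\<close>. Starting it there instead bounds the number of these walks
  by the trace on \<open>B\<close>; this takes the place of a rank bound.\<close>

lemma trace_le_cover_trace: "mtr V (W (2 * Suc j)) \<le> 2 * cover_trace (Suc j)"
proof -
  let ?l = "2 * j + 1"
  have W: "W (2 * Suc j) = W (1 + ?l)" by simp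
  have "(\<Sum>v\<in>V - B. W (2 * Suc j) v v) \<le> cover_trace (Suc j)"
  proof -
    have "(\<Sum>v\<in>V - B. W (2 * Suc j) v v) = (\<Sum>v\<in>V - B. \<Sum>w\<in>V. bmat adj v w * W ?l v w)"
      unfolding W W_split W_1 ..
    also have "\<dots> = (\<Sum>v\<in>V - B. \<Sum>w\<in>B. bmat adj v w * W ?l v w)"
    proof (rule sum.cong[OF refl])
      fix v assume v: "v \<in> V - B"
      have "\<not> adj v w" if "w \<in> V - B" for w
        using cover[of "{v, w}"] that v unfolding adj_def by auto
      then show "(\<Sum>w\<in>V. bmat adj v w * W ?l v w) = (\<Sum>w\<in>B. bmat adj v w * W ?l v w)"
        by (intro sum.mono_neutral_right finV B) (auto simp: bmat_def)
    qed
    also have "\<dots> \<le> (\<Sum>v\<in>V. \<Sum>w\<in>B. bmat adj v w * W ?l v w)"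
      using finV by (intro sum_mono2 sum_nonneg mult_nonneg_nonneg W_nonneg) (auto simp: bmat_def)
    also have "\<dots> = (\<Sum>w\<in>B. \<Sum>v\<in>V. bmat adj v w * W ?l v w)"
      by (rule sum.swap)
    also have "\<dots> = (\<Sum>w\<in>B. \<Sum>v\<in>V. bmat adj w v * W ?l w v)"
      by (intro sum.cong refl arg_cong2[of _ _ _ _ "(*)"] adj_sym W_sym)
    also have "\<dots> = cover_trace (Suc j)"
      unfolding cover_trace_def W W_split W_1 ..
    finally show ?thesis .
  qed
  then show ?thesis
    unfolding mtr_def cover_trace_def sum.subset_diff[OF B finV] by simp
qed

text \<open>The hypothesis gives \<open>?t k \<le> ?K * ?t (k - 1)\<close>, and log-convexity gives
  \<open>?t (k - 1) ^ k \<le> ?b * ?t k ^ (k - 1)\<close>; together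
  \<open>?t k \<le> ?K ^ k * ?b\<close>. This bounds \<open>cover_walks k\<close>, then
  \<open>cover_walks 1\<close> by log-convexity, then the edges. Working with \<open>k\<close>-th
  powers avoids roots.\<close>

lemma card_edges_le_if_no_rainbow_cycle:
  assumes k: "2 \<le> k" and D: "\<And>u. u \<in> V \<Longrightarrow> deg u \<le> D" and D0: "0 \<le> D"
    and no: "\<not> (\<exists>C. C \<subseteq> E \<and> is_cycle (2 * k) C \<and> rainbow c C)"
  shows "((real (card E))\<^sup>2) ^ k
    \<le> (16 * (real k)\<^sup>2 * D * real (card V) * real (card B)) ^ k * real (card B)"
proof -
  let ?b = "real (card B)" and ?t = cover_trace and ?K = "16 * (real k)\<^sup>2 * D"
  have K0: "0 \<le> ?K" using D0 by simp
  obtain l where l: "k = Suc (Suc l)" using k by (metis Suc_le_D numeral_2_eq_2 Suc_le_mono)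
  have "?t k \<le> mtr V (W (2 * k))"
    unfolding cover_trace_def mtr_def using finV B W_nonneg by (intro sum_mono2) auto
  also have "\<dots> \<le> 8 * (real k)\<^sup>2 * D * mtr V (W (2 * Suc l))"
    using trace_le_if_no_rainbow_cycle[OF k D no] by (simp add: l)
  also have "\<dots> \<le> 8 * (real k)\<^sup>2 * D * (2 * ?t (Suc l))"
    using D0 by (intro mult_left_mono trace_le_cover_trace) auto
  finally have t: "?t k \<le> ?K * ?t (Suc l)" by simp
  have tk: "?t k \<le> ?K ^ k * ?b"
  proof (cases "?t k = 0")
    case True
    then show ?thesis using K0 by simp
  next
    case False
    then have pos: "0 < ?t k ^ Suc l" using cover_trace_nonneg[of k] by simp
    have "?t k ^ Suc l * ?t k = ?t k ^ k" by (simp add: l)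
    also have "\<dots> \<le> (?K * ?t (Suc l)) ^ k"
      by (intro power_mono t cover_trace_nonneg)
    also have "\<dots> = ?K ^ k * ?t (Suc l) ^ Suc (Suc l)" by (simp only: power_mult_distrib l)
    also have "\<dots> \<le> ?K ^ k * (?b * ?t k ^ Suc l)"
      using log_convex_power_le'[of ?t "Suc l", OF cover_trace_nonneg cover_trace_log_convex] K0
      by (intro mult_left_mono) (simp_all only: cover_trace_0 l zero_le_power)
    also have "\<dots> = ?t k ^ Suc l * (?K ^ k * ?b)" by simp
    finally show ?thesis using pos by (rule mult_left_le_imp_le)
  qed
  have "((real (card E))\<^sup>2) ^ k \<le> (real (card V) * cover_walks 1) ^ k"
    by (intro power_mono card_edges_sq_le) simp
  also have "\<dots> = real (card V) ^ k * cover_walks 1 ^ Suc (Suc l)"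
    by (simp only: power_mult_distrib l)
  also have "\<dots> \<le> real (card V) ^ k * (?b ^ Suc l * cover_walks k)"
    using log_convex_power_le[of cover_walks "Suc l", OF cover_walks_nonneg cover_walks_log_convex]
    by (intro mult_left_mono) (simp_all only: cover_walks_0 l zero_le_power of_nat_0_le_iff)
  also have "\<dots> \<le> real (card V) ^ k * (?b ^ Suc l * (?b * (?K ^ k * ?b)))"
    using order_trans[OF cover_walks_le_cover_trace mult_left_mono[OF tk]]
    by (intro mult_left_mono) auto
  also have "\<dots> = (real (card V) * ?b * ?K) ^ k * ?b"
    by (simp only: power_mult_distrib l power_Suc mult_ac)
  finally show ?thesis by (simp only: mult_ac)
qed

end

section \<open>Dyadic decomposition by degrees\<close>

lemma card_edges_le_powr_if_no_rainbow_cycle: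
  assumes k: "2 \<le> k" and V: "V \<noteq> {}" and E: "E \<noteq> {}"
    and no: "\<not> (\<exists>C. C \<subseteq> E \<and> is_cycle (2 * k) C \<and> rainbow c C)"
  shows "real (card E) \<le> 800 * real k ^ 3 * (real (card V) * real (card V) powr (1 / real k))"
proof -
  let ?n = "real (card V)" and ?m = "real (card E)"
  \<comment> \<open>Half the average degree, the unit for the dyadic scale.\<close>
  define d where "d = ?m / ?n"
  define N where "N = ?n powr (1 / real k)"
  define r where "r = (1 / 2 :: real) powr (1 / real k)"
  have n1: "1 \<le> ?n" using V finV by (simp add: Suc_le_eq card_gt_0_iff)
  have m1: "1 \<le> ?m" using E finE by (simp add: Suc_le_eq card_gt_0_iff)
  have d0: "0 < d" unfolding d_def using n1 m1 by simp
  have dn: "d * ?n = ?m" unfolding d_def using n1 by simp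
  have k0: "real k \<noteq> 0" using k by simp
  have Nk: "N ^ k = ?n" and rk: "r ^ k = 1 / 2"
    unfolding N_def r_def using n1 k0 by (simp_all add: powr_powr flip: powr_realpow)
  have N0: "0 \<le> N" and r0: "0 \<le> r" unfolding N_def r_def by simp_all

  define lev where "lev = (\<lambda>v. LEAST i. deg v \<le> 2 ^ i * d)"
  have lev_ex: "\<exists>i. deg v \<le> 2 ^ i * d" for v
  proof -
    obtain i where "deg v / d < 2 ^ i" using real_arch_pow[of 2 "deg v / d"] by auto
    then show ?thesis using d0 by (auto simp: divide_simps intro: less_imp_le)
  qed
  have lev: "deg v \<le> 2 ^ lev v * d" for v
    unfolding lev_def by (rule LeastI_ex[OF lev_ex])
  have deg0: "0 \<le> deg v" for v unfolding deg_eq_card by simp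
  \<comment> \<open>Level 0 is paid for by the summand 1; on a higher level, minimality gives a
    degree above half of \<open>2 ^ lev v * d\<close>.\<close>
  have two_lev: "2 ^ lev v \<le> 1 + 2 / d * deg v" for v
  proof (cases "lev v")
    case 0
    then show ?thesis using d0 deg0[of v] by simp
  next
    case (Suc j)
    then have "\<not> deg v \<le> 2 ^ j * d"
      unfolding lev_def by (metis not_less_Least lessI)
    then have "2 ^ Suc j \<le> 2 / d * deg v" using d0 by (simp add: field_simps)
    then show ?thesis by (simp add: Suc)
  qed

  define I where "I = lev ` V"
  \<comment> \<open>Sorting edges by the higher level of their endpoints makes \<open>Bi i\<close> a
    vertex cover of \<open>Ei i\<close> and bounds the degrees in \<open>Ei i\<close> by
    \<open>2 ^ i * d\<close>.\<close>
  define Ei where "Ei = (\<lambda>i. {e \<in> E. Max (lev ` e) = i})"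
  define Bi where "Bi = (\<lambda>i. {v \<in> V. lev v = i})"
  \<comment> \<open>With \<open>D = 2 ^ i * d\<close> and the cover \<open>Bi i\<close>, the product
    of \<open>D\<close>, \<open>?n\<close> and the cover size becomes \<open>?m * y i\<close>, while
    the \<open>y i\<close> sum to at most \<open>5 * ?n\<close>.\<close>
  define y where "y = (\<lambda>i. 2 ^ i * real (card (Bi i)))"
  have finI: "finite I" unfolding I_def using finV by simp
  have "(\<Sum>i\<in>I. y i) = (\<Sum>i\<in>I. \<Sum>v\<in>Bi i. 2 ^ lev v)"
    unfolding y_def Bi_def by (intro sum.cong) auto
  also have "\<dots> = (\<Sum>v\<in>V. 2 ^ lev v)"
    unfolding Bi_def by (intro sum.group finV finI) (simp add: I_def)
  also have "\<dots> \<le> (\<Sum>v\<in>V. 1 + 2 / d * deg v)" by (intro sum_mono two_lev)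
  also have "\<dots> = ?n + 2 / d * (\<Sum>v\<in>V. deg v)" by (simp add: sum.distrib sum_distrib_left)
  also have "\<dots> \<le> ?n + 2 / d * (2 * ?m)"
    using d0 by (intro add_left_mono mult_left_mono sum_deg_le) auto
  also have "2 / d * (2 * ?m) = 4 * ?n" unfolding d_def using n1 m1 by simp
  finally have sum_y: "(\<Sum>i\<in>I. y i) \<le> 5 * ?n" by simp
  have y0: "0 \<le> y i" for i unfolding y_def by simp

  have step: "(real (card (Ei i)))\<^sup>2 \<le> (80 * (real k)\<^sup>2 * ?m * N) * y i * r ^ i" if i: "i \<in> I" for i
  proof -
    let ?b = "real (card (Bi i))" and ?D = "2 ^ i * d"
    have edge_max: "\<exists>v\<in>e. lev v = i" "\<And>v. v \<in> e \<Longrightarrow> lev v \<le> i" if e: "e \<in> Ei i" for e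
    proof -
      obtain x z where xz: "e = {x, z}" using e edge_pair[of e] unfolding Ei_def by auto
      have "Max (lev ` e) \<in> lev ` e" unfolding xz by (intro Max_in) auto
      then show "\<exists>v\<in>e. lev v = i" using e unfolding Ei_def by auto
      show "lev v \<le> i" if "v \<in> e" for v
        using e that unfolding Ei_def xz by auto
    qed
    have sub: "Ei i \<subseteq> E" unfolding Ei_def by auto
    interpret G: colored_graph V "Ei i" c
    proof
      show "simple_graph V (Ei i)" using simple sub unfolding simple_graph_def by auto
      show "proper_edge_coloring (Ei i) c"
        using proper sub unfolding proper_edge_coloring_def by (meson subsetD)
    qed
    have BV: "Bi i \<subseteq> V" unfolding Bi_def by auto
    have cover: "e \<inter> Bi i \<noteq> {}" if e: "e \<in> Ei i" for e
    proof -
      obtain v where v: "v \<in> e" "lev v = i" using edge_max(1)[OF e] by blast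
      obtain x z where "e = {x, z}" "x \<in> V" "z \<in> V" using G.edge_pair[OF e] by blast
      then have "v \<in> V" using v by auto
      then show ?thesis using v unfolding Bi_def by blast
    qed
    have D: "G.deg u \<le> ?D" if "u \<in> V" for u
    proof (cases "\<exists>w. {u, w} \<in> Ei i")
      case True
      then obtain w where "{u, w} \<in> Ei i" by blast
      then have "lev u \<le> i" using edge_max(2) by blast
      have "card {w \<in> V. {u, w} \<in> Ei i} \<le> card {w \<in> V. {u, w} \<in> E}"
        using sub finV by (intro card_mono) auto
      then have "G.deg u \<le> deg u" unfolding G.deg_eq_card deg_eq_card by simp
      also have "\<dots> \<le> 2 ^ lev u * d" by (rule lev)
      also have "\<dots> \<le> ?D" using d0 \<open>lev u \<le> i\<close> by (intro mult_right_mono power_increasing) auto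
      finally show ?thesis .
    next
      case False
      then show ?thesis unfolding G.deg_eq_card using d0 by simp
    qed
    have no': "\<not> (\<exists>C. C \<subseteq> Ei i \<and> is_cycle (2 * k) C \<and> rainbow c C)"
      using no sub by (meson order_trans)
    have main: "((real (card (Ei i)))\<^sup>2) ^ k \<le> (16 * (real k)\<^sup>2 * ?D * ?n * ?b) ^ k * ?b"
      using d0 by (intro G.card_edges_le_if_no_rainbow_cycle[OF BV cover k D _ no']) auto
    have eq: "16 * (real k)\<^sup>2 * ?D * ?n * ?b = 16 * (real k)\<^sup>2 * ?m * y i"
      unfolding y_def by (simp flip: dn)
    have "y i \<le> (\<Sum>i\<in>I. y i)" using y0 finI i by (intro member_le_sum) auto
    then have "y i \<le> 5 * ?n" using sum_y by simp
    \<comment> \<open>The constant 5 is weakened to \<open>5 ^ k\<close> so that the bound is a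
      \<open>k\<close>-th power.\<close>
    also have "\<dots> \<le> 5 ^ k * N ^ k"
      unfolding Nk using power_increasing[of 1 k "5::real"] k by (intro mult_right_mono) auto
    finally have yi: "y i \<le> 5 ^ k * N ^ k" .
    \<comment> \<open>The weight \<open>2 ^ i\<close> in \<open>y i\<close> comes back as the
      geometric decay \<open>r ^ i\<close> once the \<open>k\<close>-th root is taken.\<close>
    have "?b = y i * (r ^ k) ^ i" unfolding y_def rk by (simp add: power_divide)
    also have "\<dots> \<le> (5 ^ k * N ^ k) * (r ^ k) ^ i"
      using yi r0 by (intro mult_right_mono) auto
    also have "\<dots> = (5 * N * r ^ i) ^ k"
      by (simp add: power_mult_distrib mult.commute flip: power_mult)
    finally have b: "?b \<le> (5 * N * r ^ i) ^ k" .
    have "((real (card (Ei i)))\<^sup>2) ^ k \<le> (16 * (real k)\<^sup>2 * ?m * y i) ^ k * (5 * N * r ^ i) ^ k"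
      using main b y0[of i] unfolding eq
      by (meson mult_left_mono mult_nonneg_nonneg of_nat_0_le_iff order_trans zero_le_numeral zero_le_power zero_le_power2)
    also have "\<dots> = ((80 * (real k)\<^sup>2 * ?m * N) * y i * r ^ i) ^ k"
      unfolding power_mult_distrib[symmetric] by (intro arg_cong[of _ _ "\<lambda>x. x ^ k"]) simp
    finally show ?thesis
      using k N0 r0 y0[of i] by (subst (asm) power_mono_iff) auto
  qed
  have "(\<Sum>i\<in>I. card (Ei i)) = card E"
  proof -
    have "(\<Sum>i\<in>I. \<Sum>e | e \<in> E \<and> Max (lev ` e) = i. 1) = (\<Sum>e\<in>E. 1::nat)"
    proof (intro sum.group finE finI, clarify)
      fix e assume "e \<in> E"
      then obtain x z where xz: "e = {x, z}" "x \<in> V" "z \<in> V" using edge_pair by blast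
      have "Max (lev ` e) \<in> lev ` e" unfolding xz by (intro Max_in) auto
      then show "Max (lev ` e) \<in> I" unfolding I_def using xz by auto
    qed
    then show ?thesis unfolding Ei_def by simp
  qed
  then have "?m\<^sup>2 = (\<Sum>i\<in>I. real (card (Ei i)))\<^sup>2" by (simp flip: of_nat_sum)
  also have "\<dots> \<le> (80 * (real k)\<^sup>2 * ?m * N) * (\<Sum>i\<in>I. y i) * (2 * real k)"
    using k N0 y0 step by (intro sum_sq_le_geometric[OF _ r0 rk finI]) auto
  \<comment> \<open>The constant 800 is 80 * 5 * 2, and the geometric sum supplies the third factor
    \<open>k\<close>.\<close>
  also have "\<dots> \<le> (80 * (real k)\<^sup>2 * ?m * N) * (5 * ?n) * (2 * real k)"
    using sum_y N0 by (intro mult_right_mono mult_left_mono) auto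
  also have "\<dots> = ?m * (800 * real k ^ 3 * (?n * N))"
    by (simp add: power2_eq_square power3_eq_cube)
  finally have "?m * ?m \<le> ?m * (800 * real k ^ 3 * (?n * N))" by (simp only: power2_eq_square)
  then show ?thesis using m1 unfolding N_def by simp
qed

end

theorem theorem1p3:
  fixes V :: "'a set" and E :: "'a set set" and c :: "'a set \<Rightarrow> 'c" and k n :: nat
  assumes "k \<ge> 2"
    and "simple_graph V E" and "card V = n" and "n \<ge> 1"
    and "proper_edge_coloring E c"
    and "real (card E) \<ge> 10 ^ 5 * real k ^ 3 * real n powr (1 + 1 / real k)"
  shows "\<exists>C. C \<subseteq> E \<and> is_cycle (2 * k) C \<and> rainbow c C"
proof (rule ccontr)
  assume no: "\<not> ?thesis"
  interpret colored_graph V E c using assms by unfold_locales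
  let ?X = "real k ^ 3 * real n powr (1 + 1 / real k)"
  have X: "0 < ?X" using assms by simp
  have "real n powr (1 + 1 / real k) = real n * real n powr (1 / real k)"
    using assms by (simp add: powr_add)
  moreover have "E \<noteq> {}" using assms(6) X by auto
  moreover have "V \<noteq> {}" using assms by auto
  ultimately have "real (card E) \<le> 800 * ?X"
    using card_edges_le_powr_if_no_rainbow_cycle[OF assms(1) _ _ no] assms(3) by simp
  \<comment> \<open>As \<open>?X\<close> is positive, the upper bound \<open>800 * ?X\<close>
    contradicts the assumed \<open>10 ^ 5 * ?X\<close>.\<close>
  then show False using assms(6) X by simp
qed

end
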